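(* (1) Let $D$ be a digraph and $\ell\in\mathbb{N}$. Then there exists a complete acyclic coloring of $D$ using exactly $\ell$ colors if and only if $\vec\chi(D)\le\ell\le{\rm adi}(D)$. (2) Let $G$ be a graph and $\ell\in\mathbb{N}$. Then there exists a complete arboreal coloring of $G$ using exactly $\ell$ colors if and only if ${\rm va}(G)\le\ell\le{\rm ava}(G)$.
   Context: Graphs are finite, loopless and may have multiple edges (a bigon counts as a cycle); digraphs are finite, loopless and may have parallel and anti-parallel arcs (a digon counts as a directed cycle). The dichromatic number $\vec\chi(D)$ is the minimum number of colors in a partition of $V(D)$ into sets each inducing an acyclic subdigraph; the vertex arboricity ${\rm va}(G)$ is the minimum number of colors in a partition of $V(G)$ into sets each inducing a forest. A \emph{complete acyclic coloring} of $D$ is a partition of $V(D)$ into color classes each inducing an acyclic subdigraph such that the union of any two distinct color classes induces a subdigraph containing a directed cycle; ${\rm adi}(D)$ is the maximum number of colors in such a coloring. A \emph{complete arboreal coloring} of $G$ is a partition of $V(G)$ into color classes each inducing a forest such that the union of any two distinct color classes induces a subgraph containing a cycle; ${\rm ava}(G)$ is the maximum number of colors in such a coloring. *)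

theory Defs
  imports "Graph_Theory.Digraph_Component" "HOL-Library.Disjoint_Sets"
begin

text \<open>
  A digraph is a \<^typ>\<open>('a, 'b) pre_digraph\<close> satisfying \<^locale>\<open>fin_digraph\<close> and
  \<^locale>\<open>loopfree_digraph\<close>, so that parallel and anti-parallel arcs are allowed. A directed
  cycle is \<^const>\<open>pre_digraph.cycle\<close>: a nonempty closed walk of arcs without repeated
  vertices; in a loopfree digraph its length is at least 2, and digons are included.

  A coloring is given by its set of (nonempty) color classes, so the number of colors
  used is the cardinality of the partition.
\<close>

definition acyclic_digraph :: "('a, 'b) pre_digraph \<Rightarrow> bool" where
  "acyclic_digraph D \<longleftrightarrow> \<not> (\<exists>p. pre_digraph.cycle D p)"

definition acyclic_coloring :: "('a, 'b) pre_digraph \<Rightarrow> 'a set set \<Rightarrow> bool" where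
  "acyclic_coloring D P \<longleftrightarrow>
     partition_on (verts D) P \<and> (\<forall>A\<in>P. acyclic_digraph (D \<restriction> A))"

definition complete_acyclic_coloring :: "('a, 'b) pre_digraph \<Rightarrow> 'a set set \<Rightarrow> bool" where
  "complete_acyclic_coloring D P \<longleftrightarrow>
     acyclic_coloring D P \<and>
     (\<forall>A\<in>P. \<forall>B\<in>P. A \<noteq> B \<longrightarrow> (\<exists>p. pre_digraph.cycle (D \<restriction> (A \<union> B)) p))"

definition dichromatic_number :: "('a, 'b) pre_digraph \<Rightarrow> nat" where
  "dichromatic_number D = Min {card P |P. acyclic_coloring D P}"

definition adi :: "('a, 'b) pre_digraph \<Rightarrow> nat" where
  "adi D = Max {card P |P. complete_acyclic_coloring D P}"


text \<open>
  Undirected multigraphs are not modelled as symmetric digraphs, because there the walk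
  \<open>a, b, a\<close> along a single edge counts as a cycle. Each edge has a two-element set of end
  vertices; distinct edges may have the same ends.
\<close>

record ('v, 'e) pre_multigraph =
  mverts :: "'v set"
  medges :: "'e set"
  mends :: "'e \<Rightarrow> 'v set"

locale fin_loopfree_multigraph =
  fixes G :: "('v, 'e) pre_multigraph"
  assumes finite_mverts: "finite (mverts G)"
    and finite_medges: "finite (medges G)"
    and mends_subset: "e \<in> medges G \<Longrightarrow> mends G e \<subseteq> mverts G"
    and card_mends: "e \<in> medges G \<Longrightarrow> card (mends G e) = 2"

definition induce_multigraph ::
  "('v, 'e) pre_multigraph \<Rightarrow> 'v set \<Rightarrow> ('v, 'e) pre_multigraph" where
  "induce_multigraph G S =
     \<lparr>mverts = S, medges = {e \<in> medges G. mends G e \<subseteq> S}, mends = mends G\<rparr>"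

text \<open>
  A cycle \<open>v\<^sub>0, e\<^sub>0, v\<^sub>1, e\<^sub>1, \<dots>, v\<^sub>k\<^sub>-\<^sub>1, e\<^sub>k\<^sub>-\<^sub>1, v\<^sub>0\<close> with \<open>k \<ge> 2\<close>.
  Distinctness of the edges only matters for \<open>k = 2\<close>, where it yields exactly the bigons.
\<close>

definition multigraph_cycle ::
  "('v, 'e) pre_multigraph \<Rightarrow> 'v list \<Rightarrow> 'e list \<Rightarrow> bool" where
  "multigraph_cycle G vs es \<longleftrightarrow>
     length vs = length es \<and> 2 \<le> length vs \<and> distinct vs \<and> distinct es \<and>
     set vs \<subseteq> mverts G \<and> set es \<subseteq> medges G \<and>
     (\<forall>i<length es. mends G (es ! i) = {vs ! i, vs ! (Suc i mod length vs)})"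

definition multigraph_forest :: "('v, 'e) pre_multigraph \<Rightarrow> bool" where
  "multigraph_forest G \<longleftrightarrow> \<not> (\<exists>vs es. multigraph_cycle G vs es)"

definition arboreal_coloring :: "('v, 'e) pre_multigraph \<Rightarrow> 'v set set \<Rightarrow> bool" where
  "arboreal_coloring G P \<longleftrightarrow>
     partition_on (mverts G) P \<and> (\<forall>A\<in>P. multigraph_forest (induce_multigraph G A))"

definition complete_arboreal_coloring :: "('v, 'e) pre_multigraph \<Rightarrow> 'v set set \<Rightarrow> bool" where
  "complete_arboreal_coloring G P \<longleftrightarrow>
     arboreal_coloring G P \<and>
     (\<forall>A\<in>P. \<forall>B\<in>P. A \<noteq> B \<longrightarrow>
        (\<exists>vs es. multigraph_cycle (induce_multigraph G (A \<union> B)) vs es))"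

definition vertex_arboricity :: "('v, 'e) pre_multigraph \<Rightarrow> nat" where
  "vertex_arboricity G = Min {card P |P. arboreal_coloring G P}"

definition ava :: "('v, 'e) pre_multigraph \<Rightarrow> nat" where
  "ava G = Max {card P |P. complete_arboreal_coloring G P}"

end

theory Submission
  imports Defs
begin

text \<open>
  Both parts are instances of interpolation for a hereditary family of ``good'' subsets of a
  finite set. Let \<open>Q\<close> be a minimum coloring and \<open>P\<close> a maximum complete one. For \<open>F \<subseteq> P\<close>, cut
  the classes of \<open>F\<close> out of \<open>Q\<close> to obtain the coloring consisting of \<open>F\<close> and all \<open>B - \<Union>F\<close>
  with \<open>B \<in> Q\<close>, and let \<open>m(F)\<close> be the least number of colors in a coloring obtained from it by
  merging classes. A coloring attaining \<open>m(F)\<close> is complete, since otherwise two more classes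
  could be merged. Cutting out one further class raises \<open>m\<close> by at most one, \<open>m({}) \<le> |Q|\<close>, and
  \<open>m(P) = |P|\<close> as no two classes of \<open>P\<close> can be merged. Hence \<open>m\<close> attains every value between
  \<open>|Q|\<close> and \<open>|P|\<close>.
\<close>

section \<open>Interpolation for hereditary families of good sets\<close>

locale hereditary_family =
  fixes V :: "'a set" and good :: "'a set \<Rightarrow> bool"
  assumes finite_V: "finite V"
    and good_singleton: "x \<in> V \<Longrightarrow> good {x}"
    and good_subset: "good B \<Longrightarrow> A \<subseteq> B \<Longrightarrow> good A"
begin

definition coloring :: "'a set set \<Rightarrow> bool" where
  "coloring P \<longleftrightarrow> partition_on V P \<and> (\<forall>A\<in>P. good A)"

definition complete_coloring :: "'a set set \<Rightarrow> bool" where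
  "complete_coloring P \<longleftrightarrow> coloring P \<and> (\<forall>A\<in>P. \<forall>B\<in>P. A \<noteq> B \<longrightarrow> \<not> good (A \<union> B))"

text \<open>Coarsening is expressed by containment of pieces in classes. Thus pieces
  \<open>B - \<Union>F\<close> that have become empty need no separate treatment.\<close>

definition merged :: "'a set set \<Rightarrow> 'a set set \<Rightarrow> 'a set set \<Rightarrow> bool" where
  "merged Q F X \<longleftrightarrow>
     coloring X \<and> (\<forall>A\<in>F. \<exists>C\<in>X. A \<subseteq> C) \<and> (\<forall>B\<in>Q. \<exists>C\<in>X. B - \<Union>F \<subseteq> C)"

text \<open>\<open>LEAST\<close> is meaningful only if some coloring is merged from \<open>Q\<close>
  and \<open>F\<close>, so the lemmas on this number carry such a coloring as a witness.\<close>

definition merge_number :: "'a set set \<Rightarrow> 'a set set \<Rightarrow> nat" where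
  "merge_number Q F = (LEAST n. \<exists>X. merged Q F X \<and> card X = n)"

lemma coloring_subset_Pow: "coloring P \<Longrightarrow> P \<subseteq> Pow V"
  by (auto simp: coloring_def partition_on_def)

lemma finite_coloring: "coloring P \<Longrightarrow> finite P"
  using coloring_subset_Pow finite_V by (meson finite_Pow_iff finite_subset)

lemma finite_colorings: "finite {P. coloring P}"
  by (rule finite_subset[of _ "Pow (Pow V)"]) (use coloring_subset_Pow finite_V in auto)

lemma coloring_singletons: "coloring ((\<lambda>x. {x}) ` V)"
  using good_singleton by (auto simp: coloring_def partition_on_def disjoint_def)

lemma merged_self: "coloring Q \<Longrightarrow> merged Q {} Q"
  by (auto simp: merged_def)

lemma merge_number_le: "merged Q F X \<Longrightarrow> merge_number Q F \<le> card X"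
  unfolding merge_number_def by (rule Least_le) blast

lemma merge_number_attained:
  assumes "merged Q F X"
  obtains Y where "merged Q F Y" "card Y = merge_number Q F"
  using LeastI[of "\<lambda>n. \<exists>X. merged Q F X \<and> card X = n" "card X"] assms
  unfolding merge_number_def by blast

lemma coloring_union_classes:
  assumes X: "coloring X" and "C1 \<in> X" "C2 \<in> X" and good: "good (C1 \<union> C2)"
  shows "coloring (insert (C1 \<union> C2) (X - {C1, C2}))"
  unfolding coloring_def
proof
  have P: "partition_on V X"
    using X by (simp add: coloring_def)
  show "partition_on V (insert (C1 \<union> C2) (X - {C1, C2}))"
  proof (rule partition_onI)
    show "\<Union> (insert (C1 \<union> C2) (X - {C1, C2})) = V"
      using partition_onD1[OF P] assms(2,3) by blast
    show "{} \<notin> insert (C1 \<union> C2) (X - {C1, C2})"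
      using partition_onD3[OF P] assms(2,3) by auto
    show "disjnt p q" if "p \<in> insert (C1 \<union> C2) (X - {C1, C2})"
      "q \<in> insert (C1 \<union> C2) (X - {C1, C2})" "p \<noteq> q" for p q
    proof -
      have *: "disjnt C D" if "C \<in> X" "D \<in> X" "C \<noteq> D" for C D
        using partition_onD2[OF P] that by (auto simp: disjoint_def disjnt_def)
      show ?thesis
        using that assms(2,3) by (auto intro: * simp: disjnt_Un1 disjnt_Un2)
    qed
  qed
  show "\<forall>A\<in>insert (C1 \<union> C2) (X - {C1, C2}). good A"
    using X good by (auto simp: coloring_def)
qed

text \<open>If two classes had a good union, merging them would keep every required containment and
  save a color, against minimality.\<close>

lemma complete_of_card_merge_number:
  assumes X: "merged Q F X" and min: "card X = merge_number Q F"
  shows "complete_coloring X"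
proof -
  have col: "coloring X"
    using X by (simp add: merged_def)
  have "\<not> good (C1 \<union> C2)" if C: "C1 \<in> X" "C2 \<in> X" "C1 \<noteq> C2" for C1 C2
  proof
    assume "good (C1 \<union> C2)"
    define Y where "Y = insert (C1 \<union> C2) (X - {C1, C2})"
    have "\<exists>D\<in>Y. S \<subseteq> D" if ex: "\<exists>D\<in>X. S \<subseteq> D" for S
    proof -
      obtain D where D: "D \<in> X" "S \<subseteq> D"
        using ex by blast
      show ?thesis
      proof (cases "D \<in> {C1, C2}")
        case True
        then have "S \<subseteq> C1 \<union> C2"
          using D(2) by auto
        then show ?thesis
          unfolding Y_def by (rule bexI) simp
      next
        case False
        then show ?thesis
          using D unfolding Y_def by (intro bexI[of _ D]) auto
      qed
    qed
    moreover have "coloring Y"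
      unfolding Y_def by (rule coloring_union_classes[OF col C(1,2) \<open>good (C1 \<union> C2)\<close>])
    ultimately have "merged Q F Y"
      using X by (simp add: merged_def)
    then have "card X \<le> card Y"
      using merge_number_le min by simp
    moreover have "card Y \<le> Suc (card (X - {C1, C2}))"
      unfolding Y_def by (rule card_insert_le_m1) auto
    moreover have "card (X - {C1, C2}) = card X - 2"
      using C by (subst card_Diff_subset) auto
    \<comment> \<open>Subtraction on naturals truncates, so \<open>card X - 2\<close> gives a
      contradiction only once \<open>X\<close> is known to have at least two classes.\<close>
    moreover have "card {C1, C2} \<le> card X"
      using C finite_coloring[OF col] by (intro card_mono) auto
    ultimately show False
      using C by auto
  qed
  then show ?thesis
    using col by (simp add: complete_coloring_def)
qed

text \<open>Remove \<open>A\<close> from every class of \<open>X\<close> and make it a class of its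
  own. Heredity keeps the trimmed classes good, the members of \<open>F\<close> avoid
  \<open>A\<close> and stay intact, and each remainder of a class of \<open>Q\<close> loses just its
  part in \<open>A\<close>.\<close>

lemma merged_insert:
  assumes X: "merged Q F X" and A: "A \<noteq> {}" "A \<subseteq> V" "good A"
    and disj: "\<And>B. B \<in> F \<Longrightarrow> disjnt A B"
  shows "merged Q (insert A F) (insert A ((\<lambda>C. C - A) ` X - {{}}))"
    (is "merged Q _ ?Y")
proof -
  have col: "coloring X"
    using X by (simp add: merged_def)
  then have P: "partition_on V X"
    by (simp add: coloring_def)
  have "partition_on V ?Y"
  proof (rule partition_onI)
    show "\<Union> ?Y = V"
      using partition_onD1[OF P] A by blast
    show "{} \<notin> ?Y"
      using A by auto
    show "disjnt p q" if "p \<in> ?Y" "q \<in> ?Y" "p \<noteq> q" for p q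
    proof -
      have "disjnt (C - A) (D - A)" if "C \<in> X" "D \<in> X" "C \<noteq> D" for C D
        using partition_onD2[OF P] that by (auto simp: disjoint_def disjnt_def)
      then show ?thesis
        using that by (auto simp: disjnt_def)
    qed
  qed
  moreover have "good B" if "B \<in> ?Y" for B
    using that col A(3) good_subset[of _ B] by (auto simp: coloring_def)
  ultimately have colY: "coloring ?Y"
    by (simp add: coloring_def)
  have cover: "\<exists>C\<in>?Y. S - A \<subseteq> C" if ex: "\<exists>C\<in>X. S \<subseteq> C" for S
  proof -
    obtain C where C: "C \<in> X" "S - A \<subseteq> C - A"
      using ex by blast
    show ?thesis
    proof (cases "C - A = {}")
      case True
      \<comment> \<open>Here \<open>A\<close> has swallowed \<open>C\<close>, so
        \<open>S - A\<close> is empty and any class contains it.\<close>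
      then show ?thesis
        using C(2) by (intro bexI[of _ A]) auto
    next
      case False
      then show ?thesis
        using C by (intro bexI[of _ "C - A"]) auto
    qed
  qed
  show ?thesis
    unfolding merged_def
  proof (intro conjI ballI colY)
    fix B assume B: "B \<in> insert A F"
    show "\<exists>C\<in>?Y. B \<subseteq> C"
    proof (cases "B = A")
      case False
      then have "B - A = B"
        using B disj by (auto simp: disjnt_def)
      moreover have "\<exists>C\<in>X. B \<subseteq> C"
        using False B X by (auto simp: merged_def)
      ultimately show ?thesis
        using cover[of B] by simp
    qed auto
  next
    fix B assume "B \<in> Q"
    then have "\<exists>C\<in>X. B - \<Union>F \<subseteq> C"
      using X by (simp add: merged_def)
    moreover have "B - \<Union>(insert A F) = (B - \<Union>F) - A"
      by blast
    ultimately show "\<exists>C\<in>?Y. B - \<Union>(insert A F) \<subseteq> C"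
      using cover[of "B - \<Union>F"] by metis
  qed
qed

text \<open>Apply \<open>merged_insert\<close> to an optimal coloring: trimming creates no new
  classes, so only \<open>A\<close> itself can add a color.\<close>

lemma merge_number_insert_le:
  assumes "merged Q F X" "A \<noteq> {}" "A \<subseteq> V" "good A" "\<And>B. B \<in> F \<Longrightarrow> disjnt A B"
  shows "merge_number Q (insert A F) \<le> Suc (merge_number Q F)"
proof -
  obtain Y where Y: "merged Q F Y" "card Y = merge_number Q F"
    using assms(1) merge_number_attained by blast
  have fin: "finite Y"
    using Y finite_coloring by (auto simp: merged_def)
  have "merge_number Q (insert A F) \<le> card (insert A ((\<lambda>C. C - A) ` Y - {{}}))"
    using merge_number_le merged_insert[OF Y(1) assms(2-)] by blast
  also have "\<dots> \<le> Suc (card ((\<lambda>C. C - A) ` Y - {{}}))"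
    by (rule card_insert_le_m1) auto
  also have "\<dots> \<le> Suc (card Y)"
    using fin by (meson Diff_subset Suc_le_mono card_image_le card_mono finite_imageI le_trans)
  finally show ?thesis
    using Y by simp
qed

text \<open>Distinct classes of \<open>P\<close> lie in distinct classes of \<open>X\<close>: a
  common class would make their union good by heredity, which completeness of \<open>P\<close>
  forbids.\<close>

lemma card_le_merged:
  assumes P: "complete_coloring P" and X: "merged Q P X"
  shows "card P \<le> card X"
proof -
  obtain f where f: "\<And>A. A \<in> P \<Longrightarrow> f A \<in> X \<and> A \<subseteq> f A"
    using X unfolding merged_def by metis
  have "inj_on f P"
  proof (rule inj_onI, rule ccontr)
    fix A B assume AB: "A \<in> P" "B \<in> P" "f A = f B" "A \<noteq> B"
    have "A \<union> B \<subseteq> f A"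
      using f[OF AB(1)] f[OF AB(2)] AB(3) by simp
    moreover have "good (f A)"
      using f[OF AB(1)] X by (simp add: merged_def coloring_def)
    ultimately have "good (A \<union> B)"
      using good_subset by blast
    then show False
      using AB P by (simp add: complete_coloring_def)
  qed
  moreover have "f ` P \<subseteq> X" "finite X"
    using f X finite_coloring by (auto simp: merged_def)
  ultimately show ?thesis
    by (rule card_inj_on_le)
qed

text \<open>A discrete intermediate value argument: as the classes of \<open>P\<close> are cut out
  one at a time, \<open>merge_number\<close> starts at most at \<open>n\<close>, ends at least at
  \<open>n\<close> and never rises by more than one.\<close>

lemma complete_coloring_between:
  assumes Q: "coloring Q" and P: "complete_coloring P"
    and n: "card Q \<le> n" "n \<le> card P"
  shows "\<exists>X. complete_coloring X \<and> card X = n"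
proof -
  have colP: "coloring P" and partP: "partition_on V P"
    using P by (auto simp: complete_coloring_def coloring_def)
  \<comment> \<open>The first conjunct keeps \<open>merge_number\<close> well defined at every
    stage. The second says that reaching \<open>n\<close> or more entails having hit
    \<open>n\<close>; for empty \<open>F\<close> the bound by \<open>card Q\<close> forces
    equality.\<close>
  have hit: "(\<exists>X. merged Q F X) \<and>
      (n \<le> merge_number Q F \<longrightarrow> (\<exists>F' X. merged Q F' X \<and> merge_number Q F' = n))"
    if "finite F" "F \<subseteq> P" for F
    using that
  proof (induction rule: finite_induct)
    case empty
    then show ?case
      using merged_self[OF Q] merge_number_le[OF merged_self[OF Q]] n(1)
      by (metis le_antisym le_trans)
  next
    case (insert A F)
    then obtain X where X: "merged Q F X"
      by blast
    have A: "A \<noteq> {}" "A \<subseteq> V" "good A"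
      using insert.prems colP partP by (auto simp: coloring_def partition_on_def)
    have disj: "disjnt A B" if "B \<in> F" for B
    proof -
      have "A \<in> P" "B \<in> P" "A \<noteq> B"
        using insert.prems insert.hyps that by auto
      then show ?thesis
        using partition_onD2[OF partP] by (auto simp: disjoint_def disjnt_def)
    qed
    note step = merge_number_insert_le[OF X A disj]
    have "\<exists>X. merged Q (insert A F) X"
      using merged_insert[OF X A disj] by blast
    \<comment> \<open>Either the level \<open>n\<close> was reached before \<open>A\<close> was cut
      out, or it is crossed now, and a rise of at most one lands on it exactly.\<close>
    moreover have "n \<le> merge_number Q F \<or> n = merge_number Q (insert A F)"
      if "n \<le> merge_number Q (insert A F)"
      using step that by linarith
    ultimately show ?case
      using insert.IH insert.prems by blast
  qed
  obtain X where X: "merged Q P X" "card X = merge_number Q P"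
    using hit[OF finite_coloring[OF colP]] merge_number_attained by blast
  then have "n \<le> merge_number Q P"
    using card_le_merged[OF P] n(2) by fastforce
  then obtain F Y where "merged Q F Y" "merge_number Q F = n"
    using hit[OF finite_coloring[OF colP]] by blast
  then show ?thesis
    using merge_number_attained complete_of_card_merge_number by metis
qed

theorem interpolation:
  "(\<exists>P. complete_coloring P \<and> card P = l) \<longleftrightarrow>
     Min {card P |P. coloring P} \<le> l \<and> l \<le> Max {card P |P. complete_coloring P}"
    (is "_ \<longleftrightarrow> Min ?S \<le> l \<and> l \<le> Max ?T")
proof -
  have finS: "finite ?S"
    using finite_colorings by simp
  have "?T \<subseteq> ?S"
    by (auto simp: complete_coloring_def)
  then have finT: "finite ?T"
    using finS finite_subset by blast
  have neS: "?S \<noteq> {}"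
    using coloring_singletons by blast
  \<comment> \<open>\<open>Max\<close> needs a complete coloring to exist: an optimal merging of the
    singleton classes is one.\<close>
  obtain X where "complete_coloring X"
    using merge_number_attained[OF merged_self[OF coloring_singletons]]
      complete_of_card_merge_number by metis
  then have neT: "?T \<noteq> {}"
    by blast
  show ?thesis
  proof
    assume "\<exists>P. complete_coloring P \<and> card P = l"
    then have "l \<in> ?T"
      by blast
    moreover from this have "l \<in> ?S"
      using \<open>?T \<subseteq> ?S\<close> by blast
    ultimately show "Min ?S \<le> l \<and> l \<le> Max ?T"
      using finS finT by simp
  next
    assume l: "Min ?S \<le> l \<and> l \<le> Max ?T"
    obtain Q where "coloring Q" "card Q = Min ?S"
      using Min_in[OF finS neS] by auto
    moreover obtain P where "complete_coloring P" "card P = Max ?T"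
      using Max_in[OF finT neT] by auto
    ultimately show "\<exists>P. complete_coloring P \<and> card P = l"
      using l complete_coloring_between by metis
  qed
qed

end

section \<open>Vertex sets inducing acyclic subdigraphs\<close>

lemma cas_induce_subgraph: "pre_digraph.cas (D \<restriction> A) u p v = pre_digraph.cas D u p v"
  by (induction p arbitrary: u) (simp_all add: pre_digraph.cas.simps)

lemma awalk_verts_induce_subgraph:
  "pre_digraph.awalk_verts (D \<restriction> A) u p = pre_digraph.awalk_verts D u p"
  by (induction p arbitrary: u) (simp_all add: pre_digraph.awalk_verts.simps)

text \<open>Restriction leaves \<open>tail\<close> and \<open>head\<close> unchanged, so the same
  arc list is still a cycle; only its start vertex and arcs must belong to the larger subdigraph.
  The contrapositive is heredity of acyclicity.\<close>

lemma cycle_induce_subgraph_mono: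
  assumes "pre_digraph.cycle (D \<restriction> A) p" "A \<subseteq> B"
  shows "pre_digraph.cycle (D \<restriction> B) p"
  using assms
  unfolding pre_digraph.cycle_def pre_digraph.awalk_def cas_induce_subgraph
    awalk_verts_induce_subgraph
  by auto

text \<open>A cycle is nonempty, and its first arc would have both ends at \<open>x\<close>, hence
  be a loop.\<close>

lemma acyclic_induce_singleton:
  assumes "loopfree_digraph D"
  shows "acyclic_digraph (D \<restriction> {x})"
  unfolding acyclic_digraph_def
proof
  assume "\<exists>p. pre_digraph.cycle (D \<restriction> {x}) p"
  then obtain p where "p \<noteq> []" "set p \<subseteq> arcs (D \<restriction> {x})"
    by (auto simp: pre_digraph.cycle_def pre_digraph.awalk_def)
  then have "hd p \<in> arcs D" "tail D (hd p) = head D (hd p)"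
    using hd_in_set by fastforce+
  then show False
    using loopfree_digraph.no_loops[OF assms] by blast
qed

lemma hereditary_acyclic:
  assumes "fin_digraph D" "loopfree_digraph D"
  shows "hereditary_family (verts D) (\<lambda>A. acyclic_digraph (D \<restriction> A))"
proof
  show "finite (verts D)"
    using assms(1) by (rule fin_digraph.finite_verts)
  show "acyclic_digraph (D \<restriction> {x})" for x
    using assms(2) by (rule acyclic_induce_singleton)
  show "acyclic_digraph (D \<restriction> A)" if "acyclic_digraph (D \<restriction> B)" "A \<subseteq> B" for A B
    using that cycle_induce_subgraph_mono unfolding acyclic_digraph_def by blast
qed

section \<open>Vertex sets inducing forests\<close>

lemma multigraph_cycle_induce_mono:
  assumes "multigraph_cycle (induce_multigraph G A) vs es" "A \<subseteq> B"
  shows "multigraph_cycle (induce_multigraph G B) vs es"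
  using assms unfolding multigraph_cycle_def induce_multigraph_def by auto

text \<open>A cycle visits at least two distinct vertices.\<close>

lemma forest_induce_singleton: "multigraph_forest (induce_multigraph G {x})"
  unfolding multigraph_forest_def
proof
  assume "\<exists>vs es. multigraph_cycle (induce_multigraph G {x}) vs es"
  then obtain vs where vs: "2 \<le> length vs" "distinct vs" "set vs \<subseteq> {x}"
    by (auto simp: multigraph_cycle_def induce_multigraph_def)
  have "card (set vs) \<le> card {x}"
    using vs(3) by (intro card_mono) auto
  then show False
    using vs by (simp add: distinct_card)
qed

lemma hereditary_forest:
  assumes "fin_loopfree_multigraph G"
  shows "hereditary_family (mverts G) (\<lambda>A. multigraph_forest (induce_multigraph G A))"
proof
  show "finite (mverts G)"
    using assms by (rule fin_loopfree_multigraph.finite_mverts)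
  show "multigraph_forest (induce_multigraph G {x})" for x
    by (rule forest_induce_singleton)
  show "multigraph_forest (induce_multigraph G A)"
    if "multigraph_forest (induce_multigraph G B)" "A \<subseteq> B" for A B
    using that multigraph_cycle_induce_mono unfolding multigraph_forest_def by blast
qed

theorem theorem2p7:
  fixes D :: "('a, 'b) pre_digraph"
    and G :: "('v, 'e) pre_multigraph"
    and l :: nat
  shows "(fin_digraph D \<and> loopfree_digraph D \<longrightarrow>
            (\<exists>P. complete_acyclic_coloring D P \<and> card P = l) \<longleftrightarrow>
            dichromatic_number D \<le> l \<and> l \<le> adi D)
       \<and> (fin_loopfree_multigraph G \<longrightarrow>
            (\<exists>P. complete_arboreal_coloring G P \<and> card P = l) \<longleftrightarrow>
            vertex_arboricity G \<le> l \<and> l \<le> ava G)"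
proof (intro conjI impI)
  assume "fin_digraph D \<and> loopfree_digraph D"
  then interpret hereditary_family "verts D" "\<lambda>A. acyclic_digraph (D \<restriction> A)"
    using hereditary_acyclic by blast
  have "acyclic_coloring D = coloring"
    by (simp add: fun_eq_iff acyclic_coloring_def coloring_def)
  \<comment> \<open>Completeness is defined by the presence of a cycle, in the locale by failure of
    \<open>good\<close>. Identifying the two makes the coloring predicates equal, and with them the
    sets under \<open>Min\<close> and \<open>Max\<close>.\<close>
  moreover have "(\<exists>p. pre_digraph.cycle (D \<restriction> A) p) \<longleftrightarrow> \<not> acyclic_digraph (D \<restriction> A)" for A
    by (simp add: acyclic_digraph_def)
  ultimately have "acyclic_coloring D = coloring" "complete_acyclic_coloring D = complete_coloring"
    by (simp_all add: fun_eq_iff complete_acyclic_coloring_def complete_coloring_def)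
  then show "(\<exists>P. complete_acyclic_coloring D P \<and> card P = l) \<longleftrightarrow>
      dichromatic_number D \<le> l \<and> l \<le> adi D"
    using interpolation[of l] by (simp add: dichromatic_number_def adi_def)
next
  assume "fin_loopfree_multigraph G"
  then interpret hereditary_family "mverts G" "\<lambda>A. multigraph_forest (induce_multigraph G A)"
    by (rule hereditary_forest)
  have "arboreal_coloring G = coloring"
    by (simp add: fun_eq_iff arboreal_coloring_def coloring_def)
  moreover have "(\<exists>vs es. multigraph_cycle (induce_multigraph G A) vs es) \<longleftrightarrow>
      \<not> multigraph_forest (induce_multigraph G A)" for A
    by (simp add: multigraph_forest_def)
  ultimately have "arboreal_coloring G = coloring" "complete_arboreal_coloring G = complete_coloring"
    by (simp_all add: fun_eq_iff complete_arboreal_coloring_def complete_coloring_def)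
  then show "(\<exists>P. complete_arboreal_coloring G P \<and> card P = l) \<longleftrightarrow>
      vertex_arboricity G \<le> l \<and> l \<le> ava G"
    using interpolation[of l] by (simp add: vertex_arboricity_def ava_def)
qed

end
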